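(* Let $(R,\mathfrak{m},\mathscr{k})$ be a $d$-dimensional (Noetherian) local ring. Then $R$ is Buchsbaum if and only if there exists a binary numerical function $\varphi_R:(\mathbb{N}\cup\{\infty\})^2\to\mathbb{N}\cup\{\infty\}$ such that for any system of parameters $\mathbf{x}=x_1,\dots,x_d$ of $R$ and any $d$-tuple $\mathbf{y}=y_1,\dots,y_d\in R$, \[ \operatorname{ord}_R(x_1y_1+\cdots+x_dy_d)\leq\varphi_R\big(\ell_R(R/\mathbf{x}R),\ \operatorname{ord}_{R/((x_1,\dots,x_{d-1}):\mathfrak{m})}(y_d)\big). \]
   Context: An $n$-ary numerical function is a function $\varphi:(\mathbb{N}\cup\{\infty\})^n\to\mathbb{N}\cup\{\infty\}$ with $\varphi(a_1,\dots,a_n)=\infty$ iff some $a_i=\infty$. For a local ring $(S,\mathfrak{n})$, $\operatorname{ord}_S(x)=\sup\{n\mid x\in\mathfrak{n}^n\}$; for an ideal $J\subseteq R$, $\operatorname{ord}_{R/J}(y)$ is the order of the image of $y$ in $R/J$. $R$ is Buchsbaum if for every system of parameters $x_1,\dots,x_d$ and every $1\le i\le d$ one has $(x_1,\dots,x_{i-1}):x_i=(x_1,\dots,x_{i-1}):\mathfrak{m}$ (equivalently, $\ell_R(R/I)-e(I)$ is independent of the parameter ideal $I$, where $e(I)$ is the multiplicity). *)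

theory Defs
  imports Main "HOL-Library.Extended_Nat"
begin

definition is_ideal :: "'a::comm_ring_1 set \<Rightarrow> bool" where
  "is_ideal I \<longleftrightarrow> 0 \<in> I \<and> (\<forall>a\<in>I. \<forall>b\<in>I. a + b \<in> I) \<and> (\<forall>r. \<forall>a\<in>I. r * a \<in> I)"

definition ideal_gen :: "'a::comm_ring_1 set \<Rightarrow> 'a set" where
  "ideal_gen S = \<Inter> {I. is_ideal I \<and> S \<subseteq> I}"

definition prime_ideal :: "'a::comm_ring_1 set \<Rightarrow> bool" where
  "prime_ideal P \<longleftrightarrow> is_ideal P \<and> P \<noteq> UNIV \<and> (\<forall>a b. a * b \<in> P \<longrightarrow> a \<in> P \<or> b \<in> P)"

definition maximal_ideal :: "'a::comm_ring_1 set \<Rightarrow> bool" where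
  "maximal_ideal M \<longleftrightarrow> is_ideal M \<and> M \<noteq> UNIV \<and>
     (\<forall>J. is_ideal J \<and> M \<subseteq> J \<and> J \<noteq> UNIV \<longrightarrow> J = M)"

definition noetherian_ring :: "'a::comm_ring_1 itself \<Rightarrow> bool" where
  "noetherian_ring _ \<longleftrightarrow> (\<forall>I::'a set. is_ideal I \<longrightarrow> (\<exists>S. finite S \<and> I = ideal_gen S))"

definition local_ring :: "'a::comm_ring_1 itself \<Rightarrow> bool" where
  "local_ring _ \<longleftrightarrow> (\<exists>!M::'a set. maximal_ideal M)"

definition max_ideal :: "'a::comm_ring_1 set" where
  "max_ideal = (THE M. maximal_ideal M)"

definition krull_dim :: "'a::comm_ring_1 itself \<Rightarrow> enat" where
  "krull_dim _ = Sup {enat n | n. \<exists>P :: nat \<Rightarrow> 'a set.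
      (\<forall>i\<le>n. prime_ideal (P i)) \<and> (\<forall>i<n. P i \<subset> P (Suc i))}"

text \<open>Length of the R-module R/I: supremum of lengths of strict chains of submodules
  of R/I, i.e. of ideals I = J_0 < J_1 < ... < J_n = R.\<close>
definition length_quot :: "'a::comm_ring_1 set \<Rightarrow> enat" where
  "length_quot I = Sup {enat n | n. \<exists>J :: nat \<Rightarrow> 'a set.
      J 0 = I \<and> J n = UNIV \<and> (\<forall>i\<le>n. is_ideal (J i)) \<and> (\<forall>i<n. J i \<subset> J (Suc i))}"

definition radical :: "'a::comm_ring_1 set \<Rightarrow> 'a set" where
  "radical I = {a. \<exists>k. a ^ k \<in> I}"

definition colon :: "'a::comm_ring_1 set \<Rightarrow> 'a set \<Rightarrow> 'a set" where
  "colon I J = {r. \<forall>a\<in>J. r * a \<in> I}"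

definition max_pow :: "nat \<Rightarrow> 'a::comm_ring_1 set" where
  "max_pow n = ideal_gen {prod_list xs | xs. length xs = n \<and> set xs \<subseteq> max_ideal}"

definition ord_R :: "'a::comm_ring_1 \<Rightarrow> enat" where
  "ord_R x = Sup {enat n | n. x \<in> max_pow n}"

text \<open>ord_{R/J}(y): order of the image of y in R/J; the maximal ideal of R/J is m/J
  and (m/J)^n = (m^n + J)/J.\<close>
definition ord_quot :: "'a::comm_ring_1 set \<Rightarrow> 'a \<Rightarrow> enat" where
  "ord_quot J y = Sup {enat n | n. y \<in> {a + b | a b. a \<in> max_pow n \<and> b \<in> J}}"

definition sop :: "nat \<Rightarrow> (nat \<Rightarrow> 'a::comm_ring_1) \<Rightarrow> bool" where
  "sop d x \<longleftrightarrow> krull_dim TYPE('a) = enat d \<and> x ` {1..d} \<subseteq> max_ideal \<and>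
     radical (ideal_gen (x ` {1..d})) = max_ideal"

definition buchsbaum :: "'a::comm_ring_1 itself \<Rightarrow> bool" where
  "buchsbaum _ \<longleftrightarrow> (\<forall>d (x :: nat \<Rightarrow> 'a). sop d x \<longrightarrow>
     (\<forall>i\<in>{1..d}. colon (ideal_gen (x ` {1..<i})) {x i} =
                  colon (ideal_gen (x ` {1..<i})) max_ideal))"

definition numerical_fun2 :: "(enat \<Rightarrow> enat \<Rightarrow> enat) \<Rightarrow> bool" where
  "numerical_fun2 \<phi> \<longleftrightarrow> (\<forall>a b. \<phi> a b = \<infinity> \<longleftrightarrow> a = \<infinity> \<or> b = \<infinity>)"

end

theory Submission
  imports Defs
begin

text \<open>
  If \<open>R\<close> is Buchsbaum, then \<open>\<phi>(l, e) = l + e\<close> works. Put \<open>Q = (x\<^sub>1, \<dots>, x\<^sub>d\<^sub>-\<^sub>1)\<close> and let \<open>l\<close> be the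
  length of \<open>R/(Q + x\<^sub>d R)\<close>, so that \<open>m\<^sup>l \<subseteq> Q + x\<^sub>d R\<close>. If \<open>x\<^sub>1 y\<^sub>1 + \<dots> + x\<^sub>d y\<^sub>d\<close> lies in
  \<open>m\<^bsup>l+e+1\<^esup> \<subseteq> Q + x\<^sub>d m\<^bsup>e+1\<^esup>\<close>, then \<open>x\<^sub>d (y\<^sub>d - z) \<in> Q\<close> for some \<open>z \<in> m\<^bsup>e+1\<^esup>\<close>, hence
  \<open>y\<^sub>d - z \<in> Q : x\<^sub>d = Q : m\<close>.

  Conversely, if \<open>\<phi>\<close> exists and \<open>x\<^sub>d y\<^sub>d \<in> Q\<close>, then a sum \<open>x\<^sub>1 y\<^sub>1 + \<dots> + x\<^sub>d y\<^sub>d\<close> vanishes, which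
  forces the order of \<open>y\<^sub>d\<close> modulo \<open>Q : m\<close> to be infinite, and Krull's intersection theorem gives
  \<open>y\<^sub>d \<in> Q : m\<close>. For an index \<open>i < d\<close> this is applied to the systems of parameters
  \<open>x\<^sub>1, \<dots>, x\<^sub>i\<^sub>-\<^sub>1, x\<^sub>i\<^sub>+\<^sub>1\<^sup>n, \<dots>, x\<^sub>d\<^sup>n, x\<^sub>i\<close>, followed by Krull's theorem once more for \<open>n \<rightarrow> \<infinity>\<close>.
\<close>

section \<open>Ideals\<close>

lemma is_idealI:
  assumes "0 \<in> I" "\<And>a b. a \<in> I \<Longrightarrow> b \<in> I \<Longrightarrow> a + b \<in> I" "\<And>r a. a \<in> I \<Longrightarrow> r * a \<in> I"
  shows "is_ideal I"
  using assms unfolding is_ideal_def by blast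

lemma ideal_zero: "is_ideal I \<Longrightarrow> 0 \<in> I"
  and ideal_add: "is_ideal I \<Longrightarrow> a \<in> I \<Longrightarrow> b \<in> I \<Longrightarrow> a + b \<in> I"
  and ideal_mult: "is_ideal I \<Longrightarrow> a \<in> I \<Longrightarrow> r * a \<in> I"
  unfolding is_ideal_def by blast+

lemma ideal_mult_right: "is_ideal I \<Longrightarrow> a \<in> I \<Longrightarrow> a * r \<in> I"
  using ideal_mult[of I a r] by (simp add: mult.commute)

lemma ideal_uminus: "is_ideal I \<Longrightarrow> a \<in> I \<Longrightarrow> - a \<in> I"
  using ideal_mult[of I a "-1"] by simp

lemma ideal_diff: "is_ideal I \<Longrightarrow> a \<in> I \<Longrightarrow> b \<in> I \<Longrightarrow> a - b \<in> I"
  using ideal_add[of I a "- b"] ideal_uminus[of I b] by simp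

lemma ideal_sum_closed: "is_ideal I \<Longrightarrow> (\<And>i. i \<in> A \<Longrightarrow> f i \<in> I) \<Longrightarrow> sum f A \<in> I"
  by (induction A rule: infinite_finite_induct) (auto intro: ideal_zero ideal_add)

lemma ideal_eq_UNIV_iff: "is_ideal I \<Longrightarrow> I = UNIV \<longleftrightarrow> 1 \<in> I"
  using ideal_mult[of I 1] by auto

lemma is_ideal_UNIV: "is_ideal UNIV"
  by (rule is_idealI) auto

lemma is_ideal_Inter: "(\<And>I. I \<in> F \<Longrightarrow> is_ideal I) \<Longrightarrow> is_ideal (\<Inter>F)"
  by (rule is_idealI) (auto intro: ideal_zero ideal_add ideal_mult)

lemma is_ideal_times:
  assumes "is_ideal A"
  shows "is_ideal ((\<lambda>r. r * b) ` A)"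
proof (rule is_idealI)
  show "0 \<in> (\<lambda>r. r * b) ` A"
    using ideal_zero[OF assms] by (metis image_eqI mult_zero_left)
next
  fix u v
  assume "u \<in> (\<lambda>r. r * b) ` A" "v \<in> (\<lambda>r. r * b) ` A"
  then show "u + v \<in> (\<lambda>r. r * b) ` A"
    using ideal_add[OF assms] by (auto simp flip: distrib_right)
next
  fix r u
  assume "u \<in> (\<lambda>r. r * b) ` A"
  then show "r * u \<in> (\<lambda>r. r * b) ` A"
    using ideal_mult[OF assms] by (auto simp flip: mult.assoc)
qed

section \<open>Sums of ideals and adjoining an element\<close>

definition ideal_sum :: "'a::comm_ring_1 set \<Rightarrow> 'a set \<Rightarrow> 'a set" where
  "ideal_sum I J = {a + b | a b. a \<in> I \<and> b \<in> J}"

lemma ideal_sumI: "a \<in> I \<Longrightarrow> b \<in> J \<Longrightarrow> a + b \<in> ideal_sum I J"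
  and ideal_sumE: "z \<in> ideal_sum I J \<Longrightarrow> (\<And>a b. z = a + b \<Longrightarrow> a \<in> I \<Longrightarrow> b \<in> J \<Longrightarrow> P) \<Longrightarrow> P"
  unfolding ideal_sum_def by auto

lemma is_ideal_ideal_sum:
  assumes I: "is_ideal I" and J: "is_ideal J"
  shows "is_ideal (ideal_sum I J)"
proof (rule is_idealI)
  show "0 \<in> ideal_sum I J"
    using ideal_sumI[OF ideal_zero[OF I] ideal_zero[OF J]] by simp
next
  fix u v
  assume "u \<in> ideal_sum I J" "v \<in> ideal_sum I J"
  then obtain a b a' b' where "u = a + b" "v = a' + b'" "a \<in> I" "a' \<in> I" "b \<in> J" "b' \<in> J"
    by (metis ideal_sumE)
  then show "u + v \<in> ideal_sum I J"
    using ideal_sumI[OF ideal_add[OF I, of a a'] ideal_add[OF J, of b b']] by (simp add: ac_simps)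
next
  fix r u
  assume "u \<in> ideal_sum I J"
  then obtain a b where "u = a + b" "a \<in> I" "b \<in> J"
    by (rule ideal_sumE)
  then show "r * u \<in> ideal_sum I J"
    by (simp add: distrib_left ideal_sumI ideal_mult I J)
qed

lemma ideal_sum_upper1: "is_ideal J \<Longrightarrow> I \<subseteq> ideal_sum I J"
  using ideal_sumI[of _ I 0 J] ideal_zero[of J] by auto

lemma ideal_sum_upper2: "is_ideal I \<Longrightarrow> J \<subseteq> ideal_sum I J"
  using ideal_sumI[of 0 I _ J] ideal_zero[of I] by auto

lemma ideal_sum_mono: "I \<subseteq> I' \<Longrightarrow> ideal_sum I J \<subseteq> ideal_sum I' J"
  unfolding ideal_sum_def by blast

lemma ideal_sum_least: "is_ideal T \<Longrightarrow> I \<subseteq> T \<Longrightarrow> J \<subseteq> T \<Longrightarrow> ideal_sum I J \<subseteq> T"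
  by (auto elim!: ideal_sumE intro: ideal_add)

abbreviation adjoin :: "'a::comm_ring_1 set \<Rightarrow> 'a \<Rightarrow> 'a set" where
  "adjoin I b \<equiv> ideal_sum I (range (\<lambda>r. r * b))"

lemma is_ideal_adjoin: "is_ideal I \<Longrightarrow> is_ideal (adjoin I b)"
  by (intro is_ideal_ideal_sum is_ideal_times is_ideal_UNIV)

lemma adjoin_upper: "I \<subseteq> adjoin I b"
  by (intro ideal_sum_upper1 is_ideal_times is_ideal_UNIV)

lemma mem_adjoin: "is_ideal I \<Longrightarrow> b \<in> adjoin I b"
  using ideal_sum_upper2[of I "range (\<lambda>r. r * b)"] rangeI[of "\<lambda>r. r * b" 1] by auto

lemma adjoin_strict: "is_ideal I \<Longrightarrow> b \<notin> I \<Longrightarrow> I \<subset> adjoin I b"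
  using adjoin_upper mem_adjoin by blast

lemma adjoin_least: "is_ideal T \<Longrightarrow> I \<subseteq> T \<Longrightarrow> b \<in> T \<Longrightarrow> adjoin I b \<subseteq> T"
  by (rule ideal_sum_least) (auto intro: ideal_mult)

section \<open>Generated ideals, colon ideals and radicals\<close>

lemma is_ideal_ideal_gen: "is_ideal (ideal_gen S)"
  unfolding ideal_gen_def by (rule is_ideal_Inter) auto

lemma ideal_gen_upper: "S \<subseteq> ideal_gen S"
  unfolding ideal_gen_def by auto

lemma ideal_gen_least: "is_ideal I \<Longrightarrow> S \<subseteq> I \<Longrightarrow> ideal_gen S \<subseteq> I"
  unfolding ideal_gen_def by auto

lemma ideal_gen_mono: "S \<subseteq> T \<Longrightarrow> ideal_gen S \<subseteq> ideal_gen T"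
  using ideal_gen_least[OF is_ideal_ideal_gen] ideal_gen_upper by blast

lemma ideal_gen_insert: "ideal_gen (insert b S) = adjoin (ideal_gen S) b"
proof
  show "ideal_gen (insert b S) \<subseteq> adjoin (ideal_gen S) b"
    using ideal_gen_upper[of S] adjoin_upper[of "ideal_gen S" b]
    by (intro ideal_gen_least is_ideal_adjoin is_ideal_ideal_gen) (auto intro: mem_adjoin is_ideal_ideal_gen)
  show "adjoin (ideal_gen S) b \<subseteq> ideal_gen (insert b S)"
    using ideal_gen_upper[of "insert b S"]
    by (intro adjoin_least is_ideal_ideal_gen ideal_gen_mono) auto
qed

text \<open>Coefficients are indexed by \<open>A\<close> and not by the generators themselves, so
  repeated values of \<open>x\<close> cause no trouble and the sum has the form used in the
  theorem.\<close>

lemma ideal_gen_imageE: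
  assumes "z \<in> ideal_gen (x ` A)" "finite A"
  obtains w where "z = (\<Sum>i\<in>A. x i * w i)"
proof -
  have "\<exists>w. z = (\<Sum>i\<in>A. x i * w i)"
    using assms(2,1)
  proof (induction A arbitrary: z)
    case empty
    have "is_ideal {0}"
      by (rule is_idealI) auto
    then show ?case
      using ideal_gen_least[of "{0}" "{}"] empty by auto
  next
    case (insert j A)
    then obtain u r where u: "z = u + r * x j" "u \<in> ideal_gen (x ` A)"
      by (auto simp: ideal_gen_insert elim!: ideal_sumE)
    then obtain w where "u = (\<Sum>i\<in>A. x i * w i)"
      using insert.IH by blast
    then have "z = (\<Sum>i\<in>insert j A. x i * (w(j := r)) i)"
      using insert.hyps u(1) by (auto simp: mult.commute add.commute intro!: sum.cong)
    then show ?case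
      by blast
  qed
  then show thesis
    using that by blast
qed

lemma is_ideal_colon: "is_ideal I \<Longrightarrow> is_ideal (colon I A)"
  unfolding colon_def
  by (rule is_idealI) (auto simp: distrib_right mult.assoc intro: ideal_zero ideal_add ideal_mult)

lemma colon_upper: "is_ideal I \<Longrightarrow> I \<subseteq> colon I A"
  unfolding colon_def by (auto intro: ideal_mult_right)

lemma radical_mono: "I \<subseteq> J \<Longrightarrow> radical I \<subseteq> radical J"
  unfolding radical_def by auto

lemma radical_idem: "radical (radical I) = radical I"
proof
  show "radical (radical I) \<subseteq> radical I"
    unfolding radical_def by (auto simp flip: power_mult)
  show "radical I \<subseteq> radical (radical I)"
    unfolding radical_def by (auto, metis power_one_right)
qed

lemma is_ideal_radical:
  assumes I: "is_ideal I"
  shows "is_ideal (radical I)"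
proof (rule is_idealI)
  have "(0::'a) ^ 1 \<in> I"
    using ideal_zero[OF I] by simp
  then show "0 \<in> radical I"
    unfolding radical_def by blast
next
  fix r a
  assume "a \<in> radical I"
  then show "r * a \<in> radical I"
    unfolding radical_def by (auto simp: power_mult_distrib intro: ideal_mult I)
next
  fix a b
  assume "a \<in> radical I" "b \<in> radical I"
  then obtain k l where k: "a ^ k \<in> I" and l: "b ^ l \<in> I"
    unfolding radical_def by auto
  \<comment> \<open>In each binomial term either \<open>i\<close> is at least \<open>k\<close>, or
    the exponent of \<open>b\<close> exceeds \<open>l\<close>; so one of the two powers already lies
    in \<open>I\<close>.\<close>
  have "of_nat (k + l choose i) * a ^ i * b ^ (k + l - i) \<in> I" for i
  proof (cases "k \<le> i")
    case True
    then have "a ^ i \<in> I"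
      using ideal_mult_right[OF I k, of "a ^ (i - k)"] by (simp flip: power_add)
    then show ?thesis
      by (intro ideal_mult_right[OF I] ideal_mult[OF I])
  next
    case False
    then have "b ^ (k + l - i) \<in> I"
      using ideal_mult_right[OF I l, of "b ^ (k - i)"] by (simp add: add.commute flip: power_add)
    then show ?thesis
      by (intro ideal_mult[OF I])
  qed
  then have "(a + b) ^ (k + l) \<in> I"
    unfolding binomial_ring by (intro ideal_sum_closed I)
  then show "a + b \<in> radical I"
    unfolding radical_def by blast
qed

section \<open>Powers of the maximal ideal\<close>

lemma prod_list_max_pow: "length xs = n \<Longrightarrow> set xs \<subseteq> max_ideal \<Longrightarrow> prod_list xs \<in> max_pow n"
  unfolding max_pow_def by (rule subsetD[OF ideal_gen_upper]) blast

lemma is_ideal_max_pow: "is_ideal (max_pow n)"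
  unfolding max_pow_def by (rule is_ideal_ideal_gen)

lemma max_pow_0: "max_pow 0 = UNIV"
  using ideal_eq_UNIV_iff[OF is_ideal_max_pow] prod_list_max_pow[of "[]"] by force

lemma max_pow_least:
  assumes "is_ideal I" "\<And>xs. length xs = n \<Longrightarrow> set xs \<subseteq> max_ideal \<Longrightarrow> prod_list xs \<in> I"
  shows "max_pow n \<subseteq> I"
  unfolding max_pow_def by (rule ideal_gen_least) (use assms in auto)

text \<open>A product of \<open>k + n\<close> elements of the maximal ideal is cut after the first
  \<open>k\<close> factors. This bounds powers of the maximal ideal from above without introducing
  products of ideals.\<close>

lemma max_pow_add_least:
  assumes "is_ideal I" "\<And>a b. a \<in> max_pow k \<Longrightarrow> b \<in> max_pow n \<Longrightarrow> a * b \<in> I"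
  shows "max_pow (k + n) \<subseteq> I"
proof (rule max_pow_least[OF assms(1)])
  fix xs :: "'a list"
  assume xs: "length xs = k + n" "set xs \<subseteq> max_ideal"
  have "prod_list (take k xs) \<in> max_pow k" "prod_list (drop k xs) \<in> max_pow n"
    using xs by (auto intro!: prod_list_max_pow dest: in_set_takeD in_set_dropD)
  then have "prod_list (take k xs) * prod_list (drop k xs) \<in> I"
    by (rule assms(2))
  then show "prod_list xs \<in> I"
    by (simp flip: prod_list.append)
qed

lemma max_pow_antimono:
  assumes "k \<le> n"
  shows "max_pow n \<subseteq> max_pow k"
proof -
  have "max_pow (k + (n - k)) \<subseteq> max_pow k"
    by (rule max_pow_add_least) (auto intro: is_ideal_max_pow ideal_mult_right)
  then show ?thesis
    using assms by simp
qed

text \<open>With one factor fixed, the admissible values of the other form a colon ideal, so each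
  factor can be reduced in turn to a product of elements of the maximal ideal.\<close>

lemma max_pow_mult:
  assumes a: "a \<in> max_pow k" and b: "b \<in> max_pow n"
  shows "a * b \<in> max_pow (k + n)"
proof -
  have xs: "prod_list xs * b \<in> max_pow (k + n)" if "length xs = k" "set xs \<subseteq> max_ideal" for xs
  proof -
    have "prod_list ys \<in> colon (max_pow (k + n)) {prod_list xs}"
      if "length ys = n" "set ys \<subseteq> max_ideal" for ys
    proof -
      have "prod_list (ys @ xs) \<in> max_pow (k + n)"
        by (rule prod_list_max_pow) (use that \<open>length xs = k\<close> \<open>set xs \<subseteq> max_ideal\<close> in auto)
      then show ?thesis
        unfolding colon_def by simp
    qed
    then have "max_pow n \<subseteq> colon (max_pow (k + n)) {prod_list xs}"
      by (rule max_pow_least[OF is_ideal_colon[OF is_ideal_max_pow]])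
    then have "b * prod_list xs \<in> max_pow (k + n)"
      using b unfolding colon_def by blast
    then show ?thesis
      by (subst mult.commute)
  qed
  have "prod_list xs \<in> colon (max_pow (k + n)) {b}" if "length xs = k" "set xs \<subseteq> max_ideal" for xs
    using xs[OF that] unfolding colon_def by simp
  then have "max_pow k \<subseteq> colon (max_pow (k + n)) {b}"
    by (rule max_pow_least[OF is_ideal_colon[OF is_ideal_max_pow]])
  then show ?thesis
    using a unfolding colon_def by blast
qed

lemma max_pow_Suc_mem:
  assumes "a \<in> max_ideal" "b \<in> max_pow n"
  shows "a * b \<in> max_pow (Suc n)"
  using max_pow_mult[of a "Suc 0" b n] prod_list_max_pow[of "[a]" "Suc 0"] assms by simp

lemma power_mem_max_pow: "a \<in> max_ideal \<Longrightarrow> a ^ n \<in> max_pow n"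
  by (induction n) (auto simp: max_pow_0 max_pow_Suc_mem)

section \<open>Orders and lengths\<close>

lemma ord_R_zero: "ord_R 0 = \<infinity>"
proof -
  have "ord_R 0 = Sup (range enat)"
    unfolding ord_R_def by (simp add: ideal_zero is_ideal_max_pow full_SetCompr_eq)
  also have "\<dots> = \<infinity>"
    unfolding Sup_enat_def by (auto simp: finite_image_iff inj_on_def)
  finally show ?thesis .
qed

lemma less_ord_R_D:
  assumes "enat n < ord_R x"
  shows "x \<in> max_pow (Suc n)"
proof -
  obtain k where "x \<in> max_pow k" "n < k"
    using assms unfolding ord_R_def by (auto simp: less_Sup_iff)
  then show ?thesis
    using max_pow_antimono[of "Suc n" k] by auto
qed

lemma ord_quot_eq: "ord_quot J y = Sup {enat n | n. y \<in> ideal_sum (max_pow n) J}"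
  unfolding ord_quot_def ideal_sum_def by simp

lemma ord_quot_ge: "y \<in> ideal_sum (max_pow n) J \<Longrightarrow> enat n \<le> ord_quot J y"
  unfolding ord_quot_eq by (rule Sup_upper) auto

lemma ord_quot_eq_infinity_D:
  assumes "ord_quot J y = \<infinity>"
  shows "y \<in> ideal_sum (max_pow n) J"
proof -
  have "enat n < ord_quot J y"
    by (simp add: assms)
  then obtain k where "y \<in> ideal_sum (max_pow k) J" "n < k"
    unfolding ord_quot_eq less_Sup_iff by auto
  moreover from this have "ideal_sum (max_pow k) J \<subseteq> ideal_sum (max_pow n) J"
    by (intro ideal_sum_mono max_pow_antimono) simp
  ultimately show ?thesis
    by blast
qed

text \<open>If \<open>k'\<close> is the least exponent with \<open>max_pow k' \<subseteq> I\<close>,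
  the ideals \<open>max_pow (k' - j) + I\<close> climb strictly from \<open>I\<close> to the whole
  ring in \<open>k'\<close> steps, so \<open>k'\<close> is at most the length.\<close>

lemma length_quot_ge_exponent:
  assumes I: "is_ideal I" and k: "max_pow k \<subseteq> I" and fin: "length_quot I = enat l"
  shows "max_pow l \<subseteq> I"
proof -
  define k' where "k' = (LEAST k. max_pow k \<subseteq> I)"
  have k': "max_pow k' \<subseteq> I" and min: "\<And>j. j < k' \<Longrightarrow> \<not> max_pow j \<subseteq> I"
    using LeastI[of "\<lambda>k. max_pow k \<subseteq> I", OF k] not_less_Least unfolding k'_def by blast+
  define C where "C j = ideal_sum (max_pow (k' - j)) I" for j
  have C: "is_ideal (C j)" for j
    unfolding C_def by (intro is_ideal_ideal_sum is_ideal_max_pow I)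
  have C_upper: "max_pow (k' - j) \<subseteq> C j" "I \<subseteq> C j" for j
    unfolding C_def by (intro ideal_sum_upper1 ideal_sum_upper2 is_ideal_max_pow I)+
  have "C 0 = I"
    using ideal_sum_least[OF I k' order.refl] C_upper(2)[of 0] unfolding C_def by simp
  moreover have "C k' = UNIV"
    using C_upper(1)[of k'] by (auto simp: max_pow_0)
  moreover have "C j \<subset> C (Suc j)" if "j < k'" for j
  proof
    show "C j \<subseteq> C (Suc j)"
      unfolding C_def by (intro ideal_sum_mono max_pow_antimono) simp
    show "C j \<noteq> C (Suc j)"
    proof
      \<comment> \<open>An equality of neighbours puts \<open>m^i\<close> into
        \<open>m^(i+1) + I\<close>. Multiplying by \<open>m^n\<close> carries this to all higher
        exponents, hence \<open>m^i\<close> lies in \<open>m^k' + I = I\<close> although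
        \<open>i < k'\<close>.\<close>
      assume eq: "C j = C (Suc j)"
      define i where "i = k' - Suc j"
      have i: "max_pow i \<subseteq> ideal_sum (max_pow (Suc i)) I" "i < k'"
        using C_upper(1)[of "Suc j"] eq that unfolding C_def i_def by (auto simp: Suc_diff_Suc)
      have step: "max_pow (i + n) \<subseteq> ideal_sum (max_pow (Suc i + n)) I" for n
      proof (rule max_pow_add_least)
        show "is_ideal (ideal_sum (max_pow (Suc i + n)) I)"
          by (intro is_ideal_ideal_sum is_ideal_max_pow I)
        fix a b :: 'a
        assume a: "a \<in> max_pow i" and b: "b \<in> max_pow n"
        obtain u v where uv: "a = u + v" "u \<in> max_pow (Suc i)" "v \<in> I"
          using a i(1) by (blast elim: ideal_sumE)
        have "u * b + v * b \<in> ideal_sum (max_pow (Suc i + n)) I"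
          using uv b by (intro ideal_sumI max_pow_mult ideal_mult_right[OF I])
        then show "a * b \<in> ideal_sum (max_pow (Suc i + n)) I"
          by (simp add: uv(1) distrib_right)
      qed
      have "max_pow i \<subseteq> ideal_sum (max_pow (i + n)) I" for n
      proof (induction n)
        case 0
        show ?case by (simp add: ideal_sum_upper1 I)
      next
        case (Suc n)
        have "ideal_sum (max_pow (i + n)) I \<subseteq> ideal_sum (max_pow (i + Suc n)) I"
          using step[of n]
          by (intro ideal_sum_least is_ideal_ideal_sum is_ideal_max_pow I ideal_sum_upper2) auto
        then show ?case using Suc by blast
      qed
      from this[of "k' - i"] have "max_pow i \<subseteq> ideal_sum (max_pow k') I"
        using i(2) by simp
      then have "max_pow i \<subseteq> I"
        using ideal_sum_least[OF I k' order.refl] by blast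
      then show False
        using min i(2) by blast
    qed
  qed
  ultimately have "enat k' \<le> length_quot I"
    unfolding length_quot_def using C by (intro Sup_upper) blast
  then have "k' \<le> l"
    using fin by simp
  then show ?thesis
    using max_pow_antimono[of k' l] k' by blast
qed

section \<open>Noetherian local rings\<close>

locale noetherian_local =
  fixes R :: "'a::comm_ring_1 itself"
  assumes noetherian: "noetherian_ring TYPE('a)" and local: "local_ring TYPE('a)"
begin

text \<open>Zorn's lemma applies because the union of a chain of ideals is finitely generated: its
  generators already lie in one member, which is then the whole union. Later arguments draw maximal
  counterexamples from this.\<close>

lemma maximal_element:
  assumes "F \<noteq> {}" and ideals: "\<And>I :: 'a set. I \<in> F \<Longrightarrow> is_ideal I"
  obtains M where "M \<in> F" "\<And>I. I \<in> F \<Longrightarrow> M \<subseteq> I \<Longrightarrow> I = M"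
proof -
  have "\<Union>C \<in> F" if C: "C \<noteq> {}" "subset.chain F C" for C
  proof -
    have mem: "\<And>I. I \<in> C \<Longrightarrow> I \<in> F" and lin: "\<And>I J. I \<in> C \<Longrightarrow> J \<in> C \<Longrightarrow> I \<subseteq> J \<or> J \<subseteq> I"
      using C(2) unfolding subset_chain_def by auto
    have "is_ideal (\<Union>C)"
    proof (rule is_idealI)
      show "0 \<in> \<Union>C"
        using C(1) mem ideals ideal_zero by blast
      show "a + b \<in> \<Union>C" if "a \<in> \<Union>C" "b \<in> \<Union>C" for a b
      proof -
        from that obtain I J where "I \<in> C" "J \<in> C" "a \<in> I" "b \<in> J"
          by blast
        then show ?thesis
          using lin[of I J] mem ideals ideal_add by blast
      qed
      show "r * a \<in> \<Union>C" if "a \<in> \<Union>C" for r a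
        using that mem ideals ideal_mult by blast
    qed
    then obtain S where S: "finite S" "\<Union>C = ideal_gen S"
      using noetherian unfolding noetherian_ring_def by blast
    then have "S \<subseteq> \<Union>C"
      using ideal_gen_upper by blast
    then obtain I where I: "I \<in> C" "S \<subseteq> I"
      using finite_subset_Union_chain[OF S(1) _ C] by blast
    have "\<Union>C = I"
      using ideal_gen_least[OF ideals[OF mem[OF I(1)]] I(2)] S(2) I(1) by blast
    then show ?thesis
      using mem I(1) by simp
  qed
  then show thesis
    using subset_Zorn_nonempty[OF assms(1)] that by metis
qed

lemma maximal_ideal_max_ideal: "maximal_ideal (max_ideal :: 'a set)"
  using local unfolding local_ring_def max_ideal_def by (rule theI')

lemma is_ideal_max_ideal: "is_ideal (max_ideal :: 'a set)"
  using maximal_ideal_max_ideal unfolding maximal_ideal_def by blast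

lemma one_notin_max_ideal: "1 \<notin> (max_ideal :: 'a set)"
  using maximal_ideal_max_ideal ideal_eq_UNIV_iff unfolding maximal_ideal_def by blast

text \<open>The maximal condition yields some maximal ideal above \<open>I\<close>; locality
  identifies it with \<open>max_ideal\<close>.\<close>

lemma proper_ideal_subset_max_ideal:
  assumes I: "is_ideal (I :: 'a set)" "I \<noteq> UNIV"
  shows "I \<subseteq> max_ideal"
proof -
  obtain M where M: "M \<in> {J. is_ideal J \<and> I \<subseteq> J \<and> J \<noteq> UNIV}"
    and max: "\<And>J. J \<in> {J. is_ideal J \<and> I \<subseteq> J \<and> J \<noteq> UNIV} \<Longrightarrow> M \<subseteq> J \<Longrightarrow> J = M"
    by (rule maximal_element[of "{J. is_ideal J \<and> I \<subseteq> J \<and> J \<noteq> UNIV}"]) (use I in auto)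
  have "maximal_ideal M"
    unfolding maximal_ideal_def using M max by blast
  then have "M = max_ideal"
    using local maximal_ideal_max_ideal unfolding local_ring_def by blast
  then show ?thesis
    using M by blast
qed

lemma unit_if_notin_max_ideal:
  assumes "r \<notin> (max_ideal :: 'a set)"
  obtains s where "s * r = 1"
proof -
  have "is_ideal (range (\<lambda>s. s * r))"
    by (intro is_ideal_times is_ideal_UNIV)
  moreover have "r \<in> range (\<lambda>s. s * r)"
    using rangeI[of "\<lambda>s. s * r" 1] by simp
  ultimately have "1 \<in> range (\<lambda>s. s * r)"
    using proper_ideal_subset_max_ideal assms ideal_eq_UNIV_iff by blast
  then show thesis
    using that by (metis imageE)
qed

lemma mem_if_mult_mem:
  assumes "is_ideal I" "r * b \<in> I" "r \<notin> (max_ideal :: 'a set)"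
  shows "b \<in> I"
proof -
  obtain s where "s * r = 1"
    using unit_if_notin_max_ideal assms(3) .
  then show ?thesis
    using ideal_mult[OF assms(1,2), of s] by (simp flip: mult.assoc)
qed

text \<open>In a maximal counterexample \<open>K\<close>, an element \<open>a\<close> of
  \<open>m\<close> outside \<open>K\<close> makes both \<open>K + aR\<close> and
  \<open>K : a\<close> strictly larger, so both contain powers of \<open>m\<close>. As their product
  lies in \<open>K\<close>, so does a power of \<open>m\<close>.\<close>

lemma max_pow_subset_if_radical:
  assumes "is_ideal (I :: 'a set)" "max_ideal \<subseteq> radical I"
  shows "\<exists>n. max_pow n \<subseteq> I"
proof (rule ccontr)
  define F where "F = {K :: 'a set. is_ideal K \<and> max_ideal \<subseteq> radical K \<and> (\<nexists>n. max_pow n \<subseteq> K)}"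
  assume "\<not> ?thesis"
  then have "F \<noteq> {}"
    using assms unfolding F_def by blast
  then obtain K where "K \<in> F" and max: "\<And>J. J \<in> F \<Longrightarrow> K \<subseteq> J \<Longrightarrow> J = K"
    by (rule maximal_element) (auto simp: F_def)
  then have K: "is_ideal K" "max_ideal \<subseteq> radical K" "\<nexists>n. max_pow n \<subseteq> K"
    unfolding F_def by auto
  have larger: "\<exists>n. max_pow n \<subseteq> J" if "is_ideal J" "K \<subset> J" for J
    using max[of J] that K(2) radical_mono[of K J] unfolding F_def by blast
  have "\<not> max_pow 1 \<subseteq> K"
    using K(3) by blast
  then obtain xs where "length xs = 1" "set xs \<subseteq> max_ideal" "prod_list xs \<notin> K"
    using max_pow_least[OF K(1)] by blast
  then obtain a where a: "a \<in> max_ideal" "a \<notin> K"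
    by (cases xs) auto
  then obtain k where "a ^ k \<in> K"
    using K(2) unfolding radical_def by auto
  \<comment> \<open>Minimality of \<open>j\<close> turns \<open>a ^ (j - 1)\<close> into a witness
    that \<open>K : a\<close> is strictly larger than \<open>K\<close>.\<close>
  define j where "j = (LEAST k. a ^ k \<in> K)"
  have j: "a ^ j \<in> K" "\<And>i. i < j \<Longrightarrow> a ^ i \<notin> K"
    using LeastI[of "\<lambda>k. a ^ k \<in> K", OF \<open>a ^ k \<in> K\<close>] not_less_Least unfolding j_def by blast+
  have "j \<noteq> 0"
  proof
    assume "j = 0"
    then show False
      using j(1) K(1,3) ideal_eq_UNIV_iff by auto
  qed
  then have "a ^ (j - 1) \<in> colon K {a}" "a ^ (j - 1) \<notin> K"
    using j by (auto simp: colon_def simp flip: power_Suc2)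
  then have "K \<subset> colon K {a}"
    using colon_upper[OF K(1)] by blast
  then obtain n where n: "max_pow n \<subseteq> colon K {a}"
    using larger is_ideal_colon[OF K(1)] by blast
  obtain n' where n': "max_pow n' \<subseteq> adjoin K a"
    using larger is_ideal_adjoin adjoin_strict K(1) a(2) by metis
  have "max_pow (n' + n) \<subseteq> K"
  proof (rule max_pow_add_least[OF K(1)])
    fix u v :: 'a
    assume "u \<in> max_pow n'" and v: "v \<in> max_pow n"
    then have "u \<in> adjoin K a"
      using n' by blast
    then obtain c r where u: "u = c + r * a" "c \<in> K"
      by (auto elim!: ideal_sumE)
    have "v * a \<in> K"
      using v n unfolding colon_def by auto
    then have "c * v + r * (v * a) \<in> K"
      by (rule ideal_add[OF K(1) ideal_mult_right[OF K(1) u(2)] ideal_mult[OF K(1)]])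
    then show "u * v \<in> K"
      by (simp add: u algebra_simps)
  qed
  then show False
    using K(3) by blast
qed

section \<open>Nakayama's lemma and Krull's intersection theorem\<close>

text \<open>\<open>m N + J = N\<close> is expressed by quantifying over the ideals \<open>T \<supseteq> m N + J\<close>.\<close>
lemma nakayama:
  assumes N: "is_ideal (N :: 'a set)" and J: "is_ideal J" "J \<subseteq> N"
    and least: "\<And>T. is_ideal T \<Longrightarrow> J \<subseteq> T \<Longrightarrow> (\<And>a z. a \<in> max_ideal \<Longrightarrow> z \<in> N \<Longrightarrow> a * z \<in> T) \<Longrightarrow> N \<subseteq> T"
  shows "N = J"
proof (rule ccontr)
  assume "N \<noteq> J"
  \<comment> \<open>A maximal \<open>K\<close> with \<open>J \<subseteq> K \<subset> N\<close> takes
    the place of a minimal generating set: \<open>N\<close> is generated over \<open>K\<close> by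
    any single \<open>b\<close> outside \<open>K\<close>.\<close>
  define F where "F = {K. is_ideal K \<and> J \<subseteq> K \<and> K \<subset> N}"
  have "F \<noteq> {}"
    using J \<open>N \<noteq> J\<close> unfolding F_def by blast
  then obtain K where "K \<in> F" and max: "\<And>I. I \<in> F \<Longrightarrow> K \<subseteq> I \<Longrightarrow> I = K"
    by (rule maximal_element) (auto simp: F_def)
  then have K: "is_ideal K" "J \<subseteq> K" "K \<subset> N"
    unfolding F_def by auto
  then obtain b where b: "b \<in> N" "b \<notin> K"
    by blast
  have "K \<subset> adjoin K b" "is_ideal (adjoin K b)" "adjoin K b \<subseteq> N"
    using K b by (simp_all add: adjoin_strict is_ideal_adjoin adjoin_least[OF N] less_imp_le)
  then have Kb: "adjoin K b = N"
    using max[of "adjoin K b"] K(2) unfolding F_def by blast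
  \<comment> \<open>\<open>T = K + mb\<close> contains \<open>J\<close> and \<open>mN\<close>, so
    the hypothesis puts \<open>b\<close> into it. Then \<open>(1 - r) * b\<close> lies in
    \<open>K\<close> for some \<open>r\<close> in \<open>m\<close>, and \<open>1 - r\<close> is a
    unit.\<close>
  define T where "T = ideal_sum K ((\<lambda>r. r * b) ` max_ideal)"
  have T: "is_ideal T" "K \<subseteq> T"
    unfolding T_def
    by (intro is_ideal_ideal_sum ideal_sum_upper1 is_ideal_times is_ideal_max_ideal K)+
  have "N \<subseteq> T"
  proof (rule least)
    show "is_ideal T" "J \<subseteq> T"
      using T K(2) by auto
    fix a z :: 'a
    assume a: "a \<in> max_ideal" and "z \<in> N"
    then obtain c r where z: "z = c + r * b" "c \<in> K"
      using Kb by (auto elim!: ideal_sumE)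
    have "a * c + (a * r) * b \<in> T"
      unfolding T_def
      by (intro ideal_sumI imageI ideal_mult[OF K(1)] ideal_mult_right[OF is_ideal_max_ideal] z a)
    then show "a * z \<in> T"
      by (simp add: z algebra_simps)
  qed
  then obtain c r where c: "b = c + r * b" "c \<in> K" "r \<in> max_ideal"
    using b(1) unfolding T_def by (blast elim: ideal_sumE)
  have "(1 - r) * b = c"
    using c(1) by (simp add: algebra_simps)
  moreover have "1 - r \<notin> max_ideal"
    using ideal_add[OF is_ideal_max_ideal, of "1 - r" r] c(3) one_notin_max_ideal by auto
  ultimately show False
    using mem_if_mult_mem[OF K(1)] c(2) b(2) by blast
qed

text \<open>The ideals \<open>K : a^k\<close> ascend with \<open>k\<close>, and a maximal one among
  them equals its successor.\<close>

lemma colon_power_stable: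
  assumes K: "is_ideal (K :: 'a set)"
  shows "\<exists>k. \<forall>r. r * a ^ Suc k \<in> K \<longrightarrow> r * a ^ k \<in> K"
proof -
  obtain M where "M \<in> range (\<lambda>k. colon K {a ^ k})"
    and max: "\<And>I. I \<in> range (\<lambda>k. colon K {a ^ k}) \<Longrightarrow> M \<subseteq> I \<Longrightarrow> I = M"
    by (rule maximal_element[of "range (\<lambda>k. colon K {a ^ k})"]) (auto intro: is_ideal_colon K)
  then obtain k where k: "M = colon K {a ^ k}"
    by blast
  have "M \<subseteq> colon K {a ^ Suc k}"
  proof
    fix r
    assume "r \<in> M"
    then have "a * (r * a ^ k) \<in> K"
      unfolding k colon_def by (simp add: ideal_mult[OF K])
    then show "r \<in> colon K {a ^ Suc k}"
      unfolding colon_def by (simp add: mult.left_commute)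
  qed
  then have "colon K {a ^ Suc k} = colon K {a ^ k}"
    using max[of "colon K {a ^ Suc k}"] k by blast
  then show ?thesis
    unfolding colon_def by blast
qed

text \<open>For the intersection \<open>N\<close>, Nakayama's lemma leaves to show that every ideal
  \<open>T\<close> above \<open>J + mN\<close> contains \<open>N\<close>. An ideal \<open>K\<close>
  above \<open>T\<close>, maximal with \<open>K \<inter> N \<subseteq> T\<close>, does the work of
  the Artin-Rees lemma.\<close>

theorem krull_intersection:
  assumes J: "is_ideal (J :: 'a set)"
  shows "(\<Inter>n. ideal_sum (max_pow n) J) = J"
proof (rule nakayama)
  define N where "N = (\<Inter>n. ideal_sum (max_pow n) J)"
  show "is_ideal (\<Inter>n. ideal_sum (max_pow n) J)"
    by (rule is_ideal_Inter) (auto intro: is_ideal_ideal_sum is_ideal_max_pow J)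
  show "is_ideal J" "J \<subseteq> (\<Inter>n. ideal_sum (max_pow n) J)"
    using J ideal_sum_upper2[OF is_ideal_max_pow] by blast+
  fix T
  assume T: "is_ideal T" "J \<subseteq> T"
    and "\<And>a z. a \<in> max_ideal \<Longrightarrow> z \<in> (\<Inter>n. ideal_sum (max_pow n) J) \<Longrightarrow> a * z \<in> T"
  then have mult: "\<And>a z. a \<in> max_ideal \<Longrightarrow> z \<in> N \<Longrightarrow> a * z \<in> T"
    unfolding N_def by blast
  text \<open>A maximal \<open>K \<supseteq> T\<close> with \<open>K \<inter> N \<subseteq> T\<close> contains a power of \<open>m\<close>, hence \<open>N \<subseteq> K\<close>.\<close>
  define F where "F = {K. is_ideal K \<and> T \<subseteq> K \<and> K \<inter> N \<subseteq> T}"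
  have "F \<noteq> {}"
    using T unfolding F_def by blast
  then obtain K where "K \<in> F" and max: "\<And>I. I \<in> F \<Longrightarrow> K \<subseteq> I \<Longrightarrow> I = K"
    by (rule maximal_element) (auto simp: F_def)
  then have K: "is_ideal K" "T \<subseteq> K" "K \<inter> N \<subseteq> T"
    unfolding F_def by auto
  have "max_ideal \<subseteq> radical K"
  proof
    fix a :: 'a
    assume a: "a \<in> max_ideal"
    obtain k where k: "\<And>r. r * a ^ Suc k \<in> K \<Longrightarrow> r * a ^ k \<in> K"
      using colon_power_stable[OF K(1), of a] by blast
    \<comment> \<open>By maximality of \<open>K\<close> this forces \<open>a ^ k\<close> into
      \<open>K\<close>. For \<open>z = c + r * a ^ k\<close> in \<open>N\<close>, the product
      \<open>a * z\<close> lies in \<open>T \<subseteq> K\<close>, so \<open>r * a ^ Suc k\<close>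
      lies in \<open>K\<close>, and the choice of \<open>k\<close> brings \<open>r * a ^ k\<close>
      back into \<open>K\<close>.\<close>
    have "adjoin K (a ^ k) \<inter> N \<subseteq> T"
    proof
      fix z
      assume z: "z \<in> adjoin K (a ^ k) \<inter> N"
      then obtain c r where zc: "z = c + r * a ^ k" "c \<in> K"
        by (auto elim!: ideal_sumE)
      have "a * z \<in> K"
        using mult[OF a] z K(2) by blast
      then have "a * z - a * c \<in> K"
        using ideal_diff ideal_mult K(1) zc(2) by blast
      then have "r * a ^ Suc k \<in> K"
        by (simp add: zc(1) algebra_simps)
      then have "z \<in> K"
        using k zc ideal_add[OF K(1)] by blast
      then show "z \<in> T"
        using z K(3) by blast
    qed
    then have "adjoin K (a ^ k) = K"
      using max[of "adjoin K (a ^ k)"] is_ideal_adjoin[OF K(1)] adjoin_upper[of K "a ^ k"] K(2)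
      unfolding F_def by blast
    then show "a \<in> radical K"
      using mem_adjoin[OF K(1), of "a ^ k"] unfolding radical_def by auto
  qed
  then obtain n where "max_pow n \<subseteq> K"
    using max_pow_subset_if_radical[OF K(1)] by blast
  then have "ideal_sum (max_pow n) J \<subseteq> K"
    using T(2) K(2) by (intro ideal_sum_least K(1)) auto
  then have "N \<subseteq> K"
    unfolding N_def by blast
  then show "(\<Inter>n. ideal_sum (max_pow n) J) \<subseteq> T"
    using K(3) unfolding N_def by blast
qed

text \<open>For \<open>K\<close> maximal among the ideals with arbitrarily long chains above them,
  pick \<open>b\<close> outside \<open>K\<close> with \<open>mb\<close> inside \<open>K\<close>.
  Then \<open>(K + bR)/K\<close> is simple, so a bound \<open>c\<close> for \<open>K + bR\<close>
  gives the bound \<open>Suc c\<close> for \<open>K\<close>.\<close>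

lemma length_quot_finite:
  assumes I: "is_ideal (I :: 'a set)" and k: "max_pow k \<subseteq> I"
  shows "length_quot I \<noteq> \<infinity>"
proof -
  \<comment> \<open>Unlike in \<open>length_quot\<close>, a chain may start anywhere above
    \<open>I\<close> and end anywhere, which leaves room for changing and dropping members.\<close>
  define chain where "chain J n I \<longleftrightarrow> (\<forall>i\<le>n. is_ideal (J i) \<and> I \<subseteq> J i) \<and> (\<forall>i<n. J i \<subset> J (Suc i))"
    for J :: "nat \<Rightarrow> 'a set" and n I
  define F where "F = {I :: 'a set. is_ideal I \<and> max_pow k \<subseteq> I \<and> (\<nexists>c. \<forall>J n. chain J n I \<longrightarrow> n \<le> c)}"
  have "F = {}"
  proof (rule ccontr)
    assume "F \<noteq> {}"
    then obtain K where "K \<in> F" and max: "\<And>I. I \<in> F \<Longrightarrow> K \<subseteq> I \<Longrightarrow> I = K"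
      by (rule maximal_element) (auto simp: F_def)
    then have K: "is_ideal K" "max_pow k \<subseteq> K" "\<nexists>c. \<forall>J n. chain J n K \<longrightarrow> n \<le> c"
      unfolding F_def by auto
    have "K \<noteq> UNIV"
    proof
      assume "K = UNIV"
      then have "n \<le> 0" if "chain J n K" for J n
        using that unfolding chain_def by (cases n) blast+
      then show False
        using K(3) by blast
    qed
    \<comment> \<open>The last power of \<open>m\<close> not inside \<open>K\<close> supplies
      \<open>b\<close>; multiplying it by \<open>m\<close> leads into \<open>K\<close>.\<close>
    define j where "j = (LEAST j. max_pow j \<subseteq> K)"
    have j: "max_pow j \<subseteq> K" "\<And>i. i < j \<Longrightarrow> \<not> max_pow i \<subseteq> K"
      using LeastI[of "\<lambda>j. max_pow j \<subseteq> K", OF K(2)] not_less_Least unfolding j_def by blast+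
    have "j \<noteq> 0"
      using j(1) \<open>K \<noteq> UNIV\<close> max_pow_0 by (metis top.extremum_uniqueI)
    then obtain b where b: "b \<in> max_pow (j - 1)" "b \<notin> K"
      using j(2)[of "j - 1"] by auto
    have mb: "r * b \<in> K" if "r \<in> max_ideal" for r
      using max_pow_Suc_mem[OF that b(1)] j(1) \<open>j \<noteq> 0\<close> by auto
    have "adjoin K b \<notin> F"
      using max[of "adjoin K b"] adjoin_strict[OF K(1) b(2)] by blast
    then obtain c where c: "\<And>J n. chain J n (adjoin K b) \<Longrightarrow> n \<le> c"
      using is_ideal_adjoin[OF K(1)] adjoin_upper K(2) unfolding F_def by blast
    have "n \<le> Suc c" if J: "chain J n K" for J n
    proof -
      have ideal: "\<And>i. i \<le> n \<Longrightarrow> is_ideal (J i)" and KJ: "\<And>i. i \<le> n \<Longrightarrow> K \<subseteq> J i"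
        and strict: "\<And>i. i < n \<Longrightarrow> J i \<subset> J (Suc i)"
        using J unfolding chain_def by auto
      text \<open>Adjoining \<open>b\<close> to the ideals without \<open>b\<close>, and dropping the first one with \<open>b\<close>,
        keeps the chain strict.\<close>
      define L where "L i = (if b \<in> J i then J (Suc i) else adjoin (J i) b)" for i
      have "chain L (n - 1) (adjoin K b)" if "n \<noteq> 0"
        unfolding chain_def
      proof (intro conjI allI impI)
        fix i
        assume "i \<le> n - 1"
        then have i: "i < n"
          using that by simp
        then show "is_ideal (L i)"
          using ideal unfolding L_def by (auto intro: is_ideal_adjoin)
        have "K \<subseteq> J (Suc i)" "K \<subseteq> adjoin (J i) b"
          using KJ[of "Suc i"] KJ[of i] i adjoin_upper[of "J i" b] by auto
        moreover have "b \<in> J (Suc i)" if "b \<in> J i"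
          using strict[OF i] that by blast
        moreover have "is_ideal (J i)" "is_ideal (J (Suc i))"
          using ideal i by auto
        ultimately show "adjoin K b \<subseteq> L i"
          unfolding L_def by (simp add: adjoin_least is_ideal_adjoin mem_adjoin)
      next
        fix i
        assume "i < n - 1"
        then have i: "i < n" "Suc i < n"
          by auto
        have idi: "is_ideal (J i)" "is_ideal (J (Suc i))"
          using ideal i by auto
        consider "b \<in> J i" "b \<in> J (Suc i)" | "b \<notin> J i" "b \<in> J (Suc i)" | "b \<notin> J i" "b \<notin> J (Suc i)"
          using strict[OF i(1)] by blast
        then show "L i \<subset> L (Suc i)"
        proof cases
          case 1
          then show ?thesis
            using strict[OF i(2)] by (simp add: L_def)
        next
          case 2
          then have "adjoin (J i) b \<subseteq> J (Suc i)"
            using strict[OF i(1)] by (intro adjoin_least idi) auto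
          then show ?thesis
            using strict[OF i(2)] 2 by (auto simp: L_def)
        next
          case 3
          have "adjoin (J i) b \<subseteq> adjoin (J (Suc i)) b"
            using strict[OF i(1)] adjoin_upper[of "J (Suc i)" b] mem_adjoin[OF idi(2)]
            by (intro adjoin_least is_ideal_adjoin idi) auto
          moreover obtain z where z: "z \<in> J (Suc i)" "z \<notin> J i"
            using strict[OF i(1)] by blast
          \<comment> \<open>\<open>r * b\<close> lies in \<open>J (Suc i)\<close> but
            \<open>b\<close> does not, so \<open>r\<close> is no unit. Then \<open>r * b\<close>
            lies in \<open>K\<close>, hence in \<open>J i\<close>, and so would
            \<open>z\<close>.\<close>
          moreover have "z \<notin> adjoin (J i) b"
          proof
            assume "z \<in> adjoin (J i) b"
            then obtain u r where u: "z = u + r * b" "u \<in> J i"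
              by (auto elim!: ideal_sumE)
            have "r * b \<in> J (Suc i)"
              using ideal_diff[OF idi(2) z(1), of u] u strict[OF i(1)] by auto
            then have "r \<in> max_ideal"
              using mem_if_mult_mem[OF idi(2)] 3(2) by blast
            then have "r * b \<in> J i"
              using mb KJ[of i] i(1) by (meson less_imp_le subsetD)
            then show False
              using u z(2) ideal_add[OF idi(1)] by blast
          qed
          moreover have "z \<in> adjoin (J (Suc i)) b"
            using z(1) adjoin_upper by blast
          ultimately show ?thesis
            using 3 by (auto simp: L_def)
        qed
      qed
      then show ?thesis
        using c[of L "n - 1"] by (cases "n = 0") auto
    qed
    then show False
      using K(3) by blast
  qed
  then obtain c where c: "\<And>J n. chain J n I \<Longrightarrow> n \<le> c"
    using I k unfolding F_def by blast
  have "n \<le> c" if J: "J 0 = I" "\<forall>i\<le>n. is_ideal (J i)" "\<forall>i<n. J i \<subset> J (Suc i)" for J n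
  proof (rule c)
    have "I \<subseteq> J i" if "i \<le> n" for i
      using that by (induction i) (use J in \<open>auto simp: Suc_le_eq\<close>)
    then show "chain J n I"
      using J unfolding chain_def by blast
  qed
  then have "length_quot I \<le> enat c"
    unfolding length_quot_def by (intro Sup_least) auto
  then show ?thesis
    by (metis enat_ord_simps(5) enat.distinct(1))
qed

end

section \<open>Systems of parameters\<close>

text \<open>Meant for reordering: \<open>sop\<close> looks at the parameters only as a set.\<close>

lemma sop_image:
  assumes "sop d x" "x' ` {1..d} = x ` {1..d}"
  shows "sop d x'"
  using assms unfolding sop_def by simp

text \<open>Splitting the power gives \<open>m^(l+k) \<subseteq> Q + c m^k\<close>. Writing
  \<open>q + c * y = u + z * c\<close> accordingly, with \<open>z\<close> in \<open>m^k\<close>,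
  makes \<open>y - z\<close> a member of \<open>Q : c\<close>.\<close>

lemma mem_colon_if_sum_mem_max_pow:
  fixes q :: "'a::comm_ring_1"
  assumes Q: "is_ideal Q" and l: "max_pow l \<subseteq> adjoin Q c" and q: "q \<in> Q"
    and mem: "q + c * y \<in> max_pow (l + k)"
  shows "y \<in> ideal_sum (max_pow k) (colon Q {c})"
proof -
  define T where "T = ideal_sum Q ((\<lambda>r. r * c) ` max_pow k)"
  have "max_pow (l + k) \<subseteq> T"
  proof (rule max_pow_add_least)
    show "is_ideal T"
      unfolding T_def by (intro is_ideal_ideal_sum is_ideal_times is_ideal_max_pow Q)
    fix a b :: 'a
    assume "a \<in> max_pow l" and b: "b \<in> max_pow k"
    then obtain u r where u: "a = u + r * c" "u \<in> Q"
      using l by (blast elim: ideal_sumE)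
    have "u * b + (r * b) * c \<in> T"
      unfolding T_def using u(2) b
      by (intro ideal_sumI imageI ideal_mult_right[OF Q] ideal_mult[OF is_ideal_max_pow])
    then show "a * b \<in> T"
      by (simp add: u(1) algebra_simps)
  qed
  then obtain u z where u: "q + c * y = u + z * c" "u \<in> Q" and z: "z \<in> max_pow k"
    using mem unfolding T_def by (blast elim: ideal_sumE)
  have "(y - z) * c = u - q"
    using u(1) by (simp add: algebra_simps)
  then have "y - z \<in> colon Q {c}"
    using ideal_diff[OF Q u(2) q] by (simp add: colon_def)
  then show ?thesis
    using ideal_sumI[OF z, of "y - z"] by simp
qed

context noetherian_local
begin

lemma sop_exponent:
  assumes "sop d (x :: nat \<Rightarrow> 'a)"
  obtains k where "max_pow k \<subseteq> ideal_gen (x ` {1..d})"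
proof -
  have "max_ideal \<subseteq> radical (ideal_gen (x ` {1..d}))"
    using assms unfolding sop_def by simp
  then show thesis
    using max_pow_subset_if_radical[OF is_ideal_ideal_gen] that by blast
qed

text \<open>Each \<open>x i\<close> lies in the radical of the ideal of the powers, and radicals are
  idempotent, so both ideals have the same radical. Positive exponents keep the powers in the
  maximal ideal.\<close>

lemma sop_power:
  assumes x: "sop d (x :: nat \<Rightarrow> 'a)" and pos: "\<And>i. i \<in> {1..d} \<Longrightarrow> 0 < n i"
  shows "sop d (\<lambda>i. x i ^ n i)"
proof -
  have "x i ^ n i = x i * x i ^ (n i - 1)" if "i \<in> {1..d}" for i
    using pos[OF that] by (cases "n i") auto
  then have mem: "x i ^ n i \<in> I" if "is_ideal I" "i \<in> {1..d}" "x i \<in> I" for i I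
    using that ideal_mult_right[of I "x i"] by metis
  define I where "I = ideal_gen (x ` {1..d})"
  define I' where "I' = ideal_gen ((\<lambda>i. x i ^ n i) ` {1..d})"
  have xm: "x ` {1..d} \<subseteq> max_ideal" and rad: "radical I = max_ideal"
    using x unfolding sop_def I_def by auto
  have "I' \<subseteq> I"
    unfolding I'_def using ideal_gen_upper[of "x ` {1..d}"]
    by (intro ideal_gen_least) (auto simp: I_def is_ideal_ideal_gen intro!: mem)
  then have "radical I' \<subseteq> max_ideal"
    using radical_mono rad by blast
  moreover have "max_ideal \<subseteq> radical I'"
  proof -
    have "x ` {1..d} \<subseteq> radical I'"
      unfolding radical_def I'_def
      using ideal_gen_upper[of "(\<lambda>i. x i ^ n i) ` {1..d}"] by blast
    then have "I \<subseteq> radical I'"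
      unfolding I_def by (intro ideal_gen_least is_ideal_radical) (simp add: I'_def is_ideal_ideal_gen)
    then show ?thesis
      using radical_mono[of I "radical I'"] radical_idem rad by blast
  qed
  ultimately show ?thesis
    using x mem[OF is_ideal_max_ideal] unfolding sop_def I'_def by auto
qed

section \<open>The order bound in a Buchsbaum ring\<close>

lemma buchsbaum_order_bound:
  assumes R: "buchsbaum TYPE('a)" and d: "d \<ge> 1" and x: "sop d (x :: nat \<Rightarrow> 'a)"
  shows "ord_R (\<Sum>i=1..d. x i * y i) \<le> length_quot (ideal_gen (x ` {1..d}))
           + ord_quot (colon (ideal_gen (x ` {1..<d})) max_ideal) (y d)"
proof (rule ccontr)
  define Q where "Q = ideal_gen (x ` {1..<d})"
  have Q: "is_ideal Q"
    unfolding Q_def by (rule is_ideal_ideal_gen)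
  have range: "{1..d} = insert d {1..<d}"
    using d by auto
  then have gen: "ideal_gen (x ` {1..d}) = adjoin Q (x d)"
    by (simp add: Q_def ideal_gen_insert)
  assume contr: "\<not> ?thesis"
  \<comment> \<open>A failing bound forces a finite right-hand side, so \<open>l\<close> and
    \<open>e\<close> below are natural numbers.\<close>
  then have "length_quot (adjoin Q (x d)) + ord_quot (colon Q max_ideal) (y d) \<noteq> \<infinity>"
    unfolding gen Q_def[symmetric] by (metis enat_ord_code(3))
  then obtain l e where l: "length_quot (adjoin Q (x d)) = enat l"
    and e: "ord_quot (colon Q max_ideal) (y d) = enat e"
    by (auto simp: plus_eq_infty_iff_enat)
  have "enat (l + e) < ord_R (\<Sum>i=1..d. x i * y i)"
    using contr unfolding gen Q_def[symmetric] l e by (simp add: not_le)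
  \<comment> \<open>Strictness gains one power; that extra one raises the order of
    \<open>y d\<close> to at least \<open>Suc e\<close>, against the choice of
    \<open>e\<close>.\<close>
  then have "(\<Sum>i=1..d. x i * y i) \<in> max_pow (l + Suc e)"
    using less_ord_R_D by fastforce
  moreover have "(\<Sum>i=1..d. x i * y i) = (\<Sum>i\<in>{1..<d}. x i * y i) + x d * y d"
    unfolding range by simp
  ultimately have "(\<Sum>i\<in>{1..<d}. x i * y i) + x d * y d \<in> max_pow (l + Suc e)"
    by metis
  moreover obtain k where "max_pow k \<subseteq> adjoin Q (x d)"
    using sop_exponent[OF x] gen by metis
  then have "max_pow l \<subseteq> adjoin Q (x d)"
    by (rule length_quot_ge_exponent[OF is_ideal_adjoin[OF Q] _ l])
  moreover have "(\<Sum>i\<in>{1..<d}. x i * y i) \<in> Q"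
    using ideal_gen_upper[of "x ` {1..<d}"]
    by (intro ideal_sum_closed Q ideal_mult_right) (auto simp: Q_def)
  ultimately have "y d \<in> ideal_sum (max_pow (Suc e)) (colon Q {x d})"
    using mem_colon_if_sum_mem_max_pow[OF Q] by blast
  \<comment> \<open>The Buchsbaum condition enters here, at the index \<open>d\<close>.\<close>
  also have "colon Q {x d} = colon Q max_ideal"
    using R x d unfolding buchsbaum_def Q_def by auto
  finally show False
    using ord_quot_ge e by fastforce
qed

section \<open>From the order bound to the Buchsbaum property\<close>

lemma buchsbaum_if_order_bound:
  assumes dim: "krull_dim TYPE('a) = enat d" and \<phi>: "numerical_fun2 \<phi>"
    and bound: "\<And>(x :: nat \<Rightarrow> 'a) y. sop d x \<Longrightarrow> ord_R (\<Sum>i=1..d. x i * y i)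
      \<le> \<phi> (length_quot (ideal_gen (x ` {1..d})))
           (ord_quot (colon (ideal_gen (x ` {1..<d})) max_ideal) (y d))"
  shows "buchsbaum TYPE('a)"
  unfolding buchsbaum_def
proof (intro allI impI ballI equalityI subsetI)
  fix d' :: nat and x :: "nat \<Rightarrow> 'a" and i z
  assume "sop d' x" "i \<in> {1..d'}" and z: "z \<in> colon (ideal_gen (x ` {1..<i})) max_ideal"
  then have "x i \<in> max_ideal"
    unfolding sop_def by blast
  then show "z \<in> colon (ideal_gen (x ` {1..<i})) {x i}"
    using z unfolding colon_def by blast
next
  \<comment> \<open>The bound speaks directly only about the last index, but for every system of
    parameters.\<close>
  have last: "colon (ideal_gen (x ` {1..<d})) {x d} \<subseteq> colon (ideal_gen (x ` {1..<d})) max_ideal"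
    if x: "sop d x" and d: "d \<ge> 1" for x :: "nat \<Rightarrow> 'a"
  proof
    define Q where "Q = ideal_gen (x ` {1..<d})"
    have Q: "is_ideal Q"
      unfolding Q_def by (rule is_ideal_ideal_gen)
    fix z
    assume "z \<in> colon (ideal_gen (x ` {1..<d})) {x d}"
    then have "z * x d \<in> Q"
      unfolding colon_def Q_def by simp
    then obtain w where w: "z * x d = (\<Sum>i=1..<d. x i * w i)"
      unfolding Q_def by (rule ideal_gen_imageE) simp
    \<comment> \<open>The signs make the sum of the \<open>x i * y i\<close> vanish, so that its
      order, and with it the value of \<open>\<phi>\<close>, is infinite.\<close>
    define y where "y i = (if i = d then z else - w i)" for i
    have "{1..d} = insert d {1..<d}"
      using d by auto
    then have "(\<Sum>i=1..d. x i * y i) = x d * z - (\<Sum>i=1..<d. x i * w i)"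
      by (simp add: y_def sum_negf)
    then have "(\<Sum>i=1..d. x i * y i) = 0"
      using w by (simp add: mult.commute)
    then have "\<phi> (length_quot (ideal_gen (x ` {1..d}))) (ord_quot (colon Q max_ideal) z) = \<infinity>"
      using bound[OF x, of y] by (simp add: ord_R_zero y_def Q_def)
    \<comment> \<open>As the length is finite, the infinite value of \<open>\<phi>\<close> must come
      from its second argument.\<close>
    moreover obtain k where "max_pow k \<subseteq> ideal_gen (x ` {1..d})"
      using sop_exponent[OF x] .
    then have "length_quot (ideal_gen (x ` {1..d})) \<noteq> \<infinity>"
      by (rule length_quot_finite[OF is_ideal_ideal_gen])
    ultimately have "ord_quot (colon Q max_ideal) z = \<infinity>"
      using \<phi> unfolding numerical_fun2_def by metis
    then have "z \<in> (\<Inter>n. ideal_sum (max_pow n) (colon Q max_ideal))"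
      using ord_quot_eq_infinity_D by blast
    then show "z \<in> colon (ideal_gen (x ` {1..<d})) max_ideal"
      using krull_intersection[OF is_ideal_colon[OF Q]] unfolding Q_def by blast
  qed
  fix d' :: nat and x :: "nat \<Rightarrow> 'a" and i z
  assume x: "sop d' x" and i: "i \<in> {1..d'}" and z: "z \<in> colon (ideal_gen (x ` {1..<i})) {x i}"
  have "d' = d"
    using x dim unfolding sop_def by simp
  with x i have x: "sop d x" and i: "1 \<le> i" "i \<le> d"
    by auto
  define Q where "Q = ideal_gen (x ` {1..<i})"
  have Q: "is_ideal Q"
    unfolding Q_def by (rule is_ideal_ideal_gen)
  have "z * a \<in> ideal_sum (max_pow n) Q" if a: "a \<in> max_ideal" for a n
  proof -
    \<comment> \<open>On \<open>{1..d}\<close>, \<open>p\<close> lists the indices with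
      \<open>i\<close> moved to the end. The exponent is \<open>Suc n\<close>, not \<open>n\<close>,
      because \<open>sop_power\<close> asks for positive exponents and \<open>n\<close> may be
      0.\<close>
    define p where "p j = (if j < i then j else if j < d then Suc j else i)" for j
    define x' where "x' j = x (p j) ^ (if p j \<le> i then 1 else Suc n)" for j
    have "p ` {1..d} = {1..d}"
    proof
      show "p ` {1..d} \<subseteq> {1..d}"
        using i unfolding p_def by auto
      show "{1..d} \<subseteq> p ` {1..d}"
      proof
        fix j
        assume "j \<in> {1..d}"
        \<comment> \<open>The inverse of \<open>p\<close>, written out: \<open>i\<close> comes from
          \<open>d\<close>, and every larger index from its predecessor.\<close>
        then have "j = p (if j < i then j else if j = i then d else j - 1)"
          "(if j < i then j else if j = i then d else j - 1) \<in> {1..d}"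
          using i unfolding p_def by auto
        then show "j \<in> p ` {1..d}"
          by (rule image_eqI)
      qed
    qed
    then have "x' ` {1..d} = (\<lambda>j. x j ^ (if j \<le> i then 1 else Suc n)) ` {1..d}"
      unfolding x'_def by (metis (no_types, lifting) image_image image_cong)
    then have x': "sop d x'"
      using sop_image[OF sop_power[OF x, of "\<lambda>j. if j \<le> i then 1 else Suc n"]] by auto
    \<comment> \<open>All new parameters but the last thus lie in \<open>Q + m^n\<close>. The result
      for the last index then gives \<open>z * a\<close> in \<open>Q + m^n\<close> for every
      \<open>n\<close>, and Krull's theorem removes \<open>m^n\<close>.\<close>
    have "x' j \<in> x ` {1..<i} \<or> x' j \<in> max_pow n" if "j \<in> {1..<d}" for j
    proof (cases "j < i")
      case True
      then show ?thesis
        using that by (simp add: x'_def p_def)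
    next
      case False
      then have "x (Suc j) \<in> max_ideal"
        using that x unfolding sop_def by auto
      then have "x (Suc j) ^ Suc n \<in> max_pow n"
        using power_mem_max_pow[of "x (Suc j)" "Suc n"] max_pow_antimono[of n "Suc n"]
        by (meson le_SucI order_refl subsetD)
      then show ?thesis
        using False that by (simp add: x'_def p_def)
    qed
    moreover have "x ` {1..<i} \<subseteq> ideal_sum (max_pow n) Q"
      using order_trans[OF ideal_gen_upper ideal_sum_upper2[OF is_ideal_max_pow]]
      unfolding Q_def .
    moreover have "max_pow n \<subseteq> ideal_sum (max_pow n) Q"
      by (rule ideal_sum_upper1[OF Q])
    ultimately have "x' ` {1..<d} \<subseteq> ideal_sum (max_pow n) Q"
      by (meson image_subsetI subsetD)
    then have sub: "ideal_gen (x' ` {1..<d}) \<subseteq> ideal_sum (max_pow n) Q"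
      by (intro ideal_gen_least is_ideal_ideal_sum is_ideal_max_pow Q)
    have "x j = x' j" if "j < i" for j
      using that by (simp add: x'_def p_def)
    then have "x ` {1..<i} \<subseteq> x' ` {1..<d}"
      using i(2) by fastforce
    then have "Q \<subseteq> ideal_gen (x' ` {1..<d})"
      unfolding Q_def by (rule ideal_gen_mono)
    moreover have "x' d = x i"
      using i(2) by (simp add: x'_def p_def)
    ultimately have "z \<in> colon (ideal_gen (x' ` {1..<d})) {x' d}"
      using z unfolding colon_def Q_def by auto
    then have "z \<in> colon (ideal_gen (x' ` {1..<d})) max_ideal"
      using last[OF x'] i by auto
    then show ?thesis
      using a sub unfolding colon_def by blast
  qed
  then have "z * a \<in> Q" if "a \<in> max_ideal" for a
    using that krull_intersection[OF Q] by blast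
  then show "z \<in> colon (ideal_gen (x ` {1..<i})) max_ideal"
    unfolding colon_def Q_def by blast
qed

end

theorem theorem5p4:
  fixes d :: nat
  assumes "noetherian_ring TYPE('a::comm_ring_1)"
    and "local_ring TYPE('a)"
    and "krull_dim TYPE('a) = enat d"
    and "d \<ge> 1"
  shows "buchsbaum TYPE('a) \<longleftrightarrow>
    (\<exists>\<phi>. numerical_fun2 \<phi> \<and>
       (\<forall>(x :: nat \<Rightarrow> 'a) (y :: nat \<Rightarrow> 'a). sop d x \<longrightarrow>
          ord_R (\<Sum>i=1..d. x i * y i)
            \<le> \<phi> (length_quot (ideal_gen (x ` {1..d})))
                 (ord_quot (colon (ideal_gen (x ` {1..<d})) max_ideal) (y d))))"
proof -
  interpret noetherian_local "TYPE('a)"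
    by unfold_locales (rule assms)+
  have "numerical_fun2 (+)"
    unfolding numerical_fun2_def by (simp add: plus_eq_infty_iff_enat)
  show ?thesis
  proof
    assume "buchsbaum TYPE('a)"
    note bound = buchsbaum_order_bound[OF this assms(4)]
    show "\<exists>\<phi>. numerical_fun2 \<phi> \<and>
       (\<forall>(x :: nat \<Rightarrow> 'a) (y :: nat \<Rightarrow> 'a). sop d x \<longrightarrow>
          ord_R (\<Sum>i=1..d. x i * y i)
            \<le> \<phi> (length_quot (ideal_gen (x ` {1..d})))
                 (ord_quot (colon (ideal_gen (x ` {1..<d})) max_ideal) (y d)))"
      by (intro exI[of _ "(+)"] conjI allI impI bound \<open>numerical_fun2 (+)\<close>)
  next
    assume "\<exists>\<phi>. numerical_fun2 \<phi> \<and>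
       (\<forall>(x :: nat \<Rightarrow> 'a) (y :: nat \<Rightarrow> 'a). sop d x \<longrightarrow>
          ord_R (\<Sum>i=1..d. x i * y i)
            \<le> \<phi> (length_quot (ideal_gen (x ` {1..d})))
                 (ord_quot (colon (ideal_gen (x ` {1..<d})) max_ideal) (y d)))"
    then obtain \<phi> where "numerical_fun2 \<phi>"
      and bound: "\<And>(x :: nat \<Rightarrow> 'a) y. sop d x \<Longrightarrow> ord_R (\<Sum>i=1..d. x i * y i)
        \<le> \<phi> (length_quot (ideal_gen (x ` {1..d})))
             (ord_quot (colon (ideal_gen (x ` {1..<d})) max_ideal) (y d))"
      by (elim exE conjE) (simp only: simp_thms)
    then show "buchsbaum TYPE('a)"
      by (rule buchsbaum_if_order_bound[OF assms(3)])
  qed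
qed

end
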